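(* Let $\boldsymbol\lambda:\mathbb N\to\{-1,1\}$ be the Liouville function, and assume the Chowla conjecture: for every $k\ge1$ and all distinct non-negative integers $s_1,\dots,s_k$, $$\frac1N\sum_{n=1}^N\boldsymbol\lambda(n+s_1)\cdots\boldsymbol\lambda(n+s_k)\longrightarrow0\quad(N\to\infty).$$ Let $X_{\boldsymbol\lambda}\subset\{-1,1\}^{\mathbb N}$ be the closure of the orbit of $\boldsymbol\lambda$ under the shift $S\omega=(\omega(n+1))_{n}$. Then for almost every $\omega\in X_{\boldsymbol\lambda}$ with respect to the Bernoulli measure $\bigotimes_{k\in\mathbb N}\bigl(\tfrac12\delta_1+\tfrac12\delta_{-1}\bigr)$, for every $\tau>\frac12$, $$\sup_{x^\tau\le h\le x}\left|\frac1h\bigl(M_\omega(x+h)-M_\omega(x)\bigr)\right|\longrightarrow0\quad (x\to+\infty).$$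
   Context: For $\omega\in\{-1,1\}^{\mathbb N}$ the random Mertens function is $M_\omega(x)=\sum_{n\le x}\omega(n)$ (sum over positive integers $n\le x$). The Liouville function is $\boldsymbol\lambda(n)=1$ if the number of prime factors of $n$, counted with multiplicity, is even and $-1$ otherwise. *)

theory Defs
  imports "HOL-Probability.Probability" "HOL-Computational_Algebra.Primes"
begin

text \<open>Sequences in \<open>{-1,1}\<^sup>\<nat>\<close>, where \<open>\<nat> = {1, 2, 3, \<dots>}\<close>, are the elements of
  \<open>{1..} \<rightarrow>\<^sub>E {-1, 1}\<close>: functions on \<^typ>\<open>nat\<close> with the fixed value
  \<^term>\<open>undefined\<close> at the irrelevant argument \<open>0\<close>.\<close>

definition full_shift :: "(nat \<Rightarrow> int) topology" where
  "full_shift = product_topology (\<lambda>_. discrete_topology {-1, 1}) {1..}"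

definition bernoulli_measure :: "(nat \<Rightarrow> int) measure" where
  "bernoulli_measure = PiM {1..} (\<lambda>_. uniform_count_measure {-1, 1})"

definition shift :: "(nat \<Rightarrow> int) \<Rightarrow> nat \<Rightarrow> int" where
  "shift \<omega> = (\<lambda>n\<in>{1..}. \<omega> (n + 1))"

definition orbit_closure :: "(nat \<Rightarrow> int) \<Rightarrow> (nat \<Rightarrow> int) set" where
  "orbit_closure \<omega> = full_shift closure_of range (\<lambda>m. (shift ^^ m) \<omega>)"

definition random_mertens :: "(nat \<Rightarrow> int) \<Rightarrow> real \<Rightarrow> int" where
  "random_mertens \<omega> x = (\<Sum>n | 1 \<le> n \<and> real n \<le> x. \<omega> n)"

definition liouville :: "nat \<Rightarrow> int" where
  "liouville n = (if even (size (prime_factorization n)) then 1 else - 1)"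

definition chowla_conjecture :: bool where
  "chowla_conjecture \<longleftrightarrow>
    (\<forall>k\<ge>1. \<forall>s :: nat \<Rightarrow> nat. inj_on s {1..k} \<longrightarrow>
      (\<lambda>N. 1 / real N * (\<Sum>n=1..N. real_of_int (\<Prod>i=1..k. liouville (n + s i)))) \<longlonglongrightarrow> 0)"

text \<open>The supremum is taken in \<open>[0, \<infinity>]\<close>, so that over the empty range of \<open>h\<close>
  (which occurs for \<open>\<tau> > 1\<close>) it is \<open>0\<close>; on \<^typ>\<open>real\<close> it would be unspecified.\<close>

definition short_interval_sup :: "(nat \<Rightarrow> int) \<Rightarrow> real \<Rightarrow> real \<Rightarrow> ennreal" where
  "short_interval_sup \<omega> \<tau> x =
    (SUP h\<in>{x powr \<tau>..x}.
      ennreal \<bar>1 / h * (real_of_int (random_mertens \<omega> (x + h)) - real_of_int (random_mertens \<omega> x))\<bar>)"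

end

theory Submission
  imports Defs "HOL-Real_Asymp.Real_Asymp"
begin

text \<open>Two unrelated facts meet here. On the topological side, the conjecture makes all finite
  sign patterns equidistributed along the Liouville function: the indicator of a pattern is a
  polynomial in the shifted values, and all its non-constant terms have mean zero. Every pattern
  therefore occurs, and the orbit closure is the whole space of sign sequences
  (\<open>chowla_imp_orbit_closure_full\<close>), so that the Bernoulli measure is carried by it.

  On the probabilistic side, a block of \<open>m\<close> independent fair signs has a sum of size at least
  \<open>\<epsilon> m\<close> with probability at most \<open>2 exp (- \<epsilon>\<^sup>2 m / 2)\<close>, by Hoeffding's inequality. An interval
  \<open>(x, x + h]\<close> with \<open>h \<ge> sqrt x\<close> meets the integers in a block whose starting point is at
  most of order \<open>m\<^sup>2\<close>. Grouping the blocks by length rather than by starting point therefore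
  leaves only polynomially many for each \<open>m\<close>, and Borel--Cantelli shows that almost surely
  all long ones are balanced (\<open>AE_block_sums_small\<close>). The exponent \<open>1/2\<close> serves all larger
  \<open>\<tau>\<close> at once, so the only null sets to be united are those for \<open>\<epsilon> = 1, 1/2, 1/3, \<dots>\<close>.\<close>


section \<open>The orbit closure of the Liouville function\<close>

lemma liouville_values: "liouville n \<in> {-1, 1}"
  by (simp add: liouville_def)

lemma chowla_finite_set:
  assumes "chowla_conjecture" "finite A" "A \<noteq> {}"
  shows "(\<lambda>N. 1 / real N * (\<Sum>n=1..N. real_of_int (\<Prod>i\<in>A. liouville (n + i)))) \<longlonglongrightarrow> 0"
proof -
  obtain s where s: "bij_betw s {1..card A} A"
    using ex_bij_betw_nat_finite_1[OF \<open>finite A\<close>] by blast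
  have "card A \<ge> 1"
    using assms(2,3) by (simp add: Suc_le_eq card_gt_0_iff)
  hence "(\<lambda>N. 1 / real N * (\<Sum>n=1..N. real_of_int (\<Prod>i=1..card A. liouville (n + s i)))) \<longlonglongrightarrow> 0"
    using assms(1) s unfolding chowla_conjecture_def bij_betw_def by blast
  moreover have "(\<Prod>i=1..card A. liouville (n + s i)) = (\<Prod>i\<in>A. liouville (n + i))" for n
    by (rule prod.reindex_bij_betw[OF s])
  ultimately show ?thesis by (simp only:)
qed

text \<open>Each factor \<open>1 + w i * liouville (n + i)\<close> is \<open>2\<close> or \<open>0\<close> according as the sign at
  \<open>n + i\<close> is the prescribed one or not, so the product detects the pattern \<open>w\<close>. Expanded over the
  subsets of \<open>A\<close>, its mean is \<open>1\<close> from the empty subset plus correlations that vanish by the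
  conjecture; a mean tending to \<open>1\<close> cannot come from a product that is always zero.\<close>

lemma chowla_imp_pattern_occurs:
  assumes "chowla_conjecture" "finite A" and w: "\<And>i. i \<in> A \<Longrightarrow> w i \<in> {-1, 1::int}"
  shows "\<exists>n. \<forall>i\<in>A. liouville (n + i) = w i"
proof (rule ccontr)
  assume contra: "\<nexists>n. \<forall>i\<in>A. liouville (n + i) = w i"
  define c where "c X N = 1 / real N * (\<Sum>n=1..N. real_of_int (\<Prod>i\<in>X. liouville (n + i)))" for X N
  have "(\<Prod>i\<in>A. w i * liouville (n + i) + 1) = 0" for n
  proof -
    obtain i where i: "i \<in> A" "liouville (n + i) \<noteq> w i"
      using contra by blast
    hence "w i * liouville (n + i) + 1 = 0"
      using w[OF i(1)] liouville_values[of "n + i"] by auto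
    with i(1) assms(2) show ?thesis by (auto simp: prod_zero_iff)
  qed
  hence *: "(\<Sum>X\<in>Pow A. (\<Prod>i\<in>X. w i) * (\<Prod>i\<in>X. liouville (n + i))) = 0" for n
    using prod_add[OF assms(2), of "\<lambda>i. w i * liouville (n + i)" "\<lambda>_. 1"]
    by (simp add: prod.distrib)
  have "(\<Sum>X\<in>Pow A. real_of_int (\<Prod>i\<in>X. w i) * c X N)
      = 1 / real N * (\<Sum>n=1..N. real_of_int
          (\<Sum>X\<in>Pow A. (\<Prod>i\<in>X. w i) * (\<Prod>i\<in>X. liouville (n + i))))" for N
    unfolding c_def of_int_sum of_int_mult sum_distrib_left
    by (subst sum.swap) (simp add: mult_ac)
  hence zero: "(\<Sum>X\<in>Pow A. real_of_int (\<Prod>i\<in>X. w i) * c X N) = 0" for N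
    by (simp only: *) simp
  have "(\<lambda>N. \<Sum>X\<in>Pow A. real_of_int (\<Prod>i\<in>X. w i) * c X N)
      \<longlonglongrightarrow> (\<Sum>X\<in>Pow A. if X = {} then 1 else 0)"
  proof (intro tendsto_sum)
    fix X assume X: "X \<in> Pow A"
    show "(\<lambda>N. real_of_int (\<Prod>i\<in>X. w i) * c X N) \<longlonglongrightarrow> (if X = {} then 1 else 0)"
    proof (cases "X = {}")
      case True
      have "\<forall>\<^sub>F N in sequentially. real_of_int (\<Prod>i\<in>X. w i) * c X N = 1"
        using eventually_gt_at_top[of 0] by eventually_elim (simp add: True c_def)
      thus ?thesis using True by (simp add: tendsto_eventually)
    next
      case False
      have "c X \<longlonglongrightarrow> 0"
        unfolding c_def using chowla_finite_set[OF assms(1) _ False] X assms(2)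
        by (auto intro: finite_subset)
      thus ?thesis using False tendsto_mult_right_zero by auto
    qed
  qed
  moreover have "(\<Sum>X\<in>Pow A. if X = {} then 1 else (0::real)) = 1"
    using assms(2) by simp
  ultimately have "(\<lambda>N. 0) \<longlonglongrightarrow> (1::real)"
    by (simp only: zero)
  thus False
    using LIMSEQ_unique[OF tendsto_const] by fastforce
qed

lemma shift_funpow_restrict: "(shift ^^ m) (restrict f {1..}) = (\<lambda>n\<in>{1..}. f (n + m))"
  by (induction m) (auto simp: shift_def restrict_def fun_eq_iff)

text \<open>A basic open neighbourhood in the product topology constrains finitely many coordinates only,
  and any finite pattern of signs occurs in the Liouville function; hence its orbit is dense.\<close>

lemma chowla_imp_orbit_closure_full:
  assumes "chowla_conjecture"
  shows "orbit_closure (restrict liouville {1..}) = {1..} \<rightarrow>\<^sub>E {-1, 1}"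
proof (intro equalityI subsetI)
  fix \<omega> assume "\<omega> \<in> orbit_closure (restrict liouville {1..})"
  thus "\<omega> \<in> {1..} \<rightarrow>\<^sub>E {-1, 1}"
    by (auto simp: orbit_closure_def full_shift_def in_closure_of)
next
  fix \<omega> :: "nat \<Rightarrow> int" assume \<omega>: "\<omega> \<in> {1..} \<rightarrow>\<^sub>E {-1, 1}"
  have "\<exists>y. y \<in> range (\<lambda>m. (shift ^^ m) (restrict liouville {1..})) \<and> y \<in> T"
    if T: "\<omega> \<in> T" "openin full_shift T" for T
  proof -
    obtain U where U: "finite {i \<in> {1..}. U i \<noteq> {-1, 1}}" "\<omega> \<in> Pi\<^sub>E {1..} U" "Pi\<^sub>E {1..} U \<subseteq> T"
      using T unfolding full_shift_def openin_product_topology_alt by auto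
    define A where "A = {i \<in> {1..}. U i \<noteq> {-1, 1}}"
    obtain m where m: "\<forall>i\<in>A. liouville (m + i) = \<omega> i"
      using chowla_imp_pattern_occurs[OF assms U(1), of \<omega>] \<omega> unfolding A_def by (auto simp: PiE_iff)
    have "liouville (i + m) \<in> U i" if "i \<ge> 1" for i
    proof (cases "i \<in> A")
      case True
      thus ?thesis using m U(2) that by (auto simp: PiE_iff add.commute)
    next
      case False
      hence "U i = {-1, 1}" using that by (simp add: A_def)
      thus ?thesis using liouville_values by simp
    qed
    hence "(shift ^^ m) (restrict liouville {1..}) \<in> Pi\<^sub>E {1..} U"
      unfolding shift_funpow_restrict by (auto simp: PiE_iff)
    thus ?thesis using U(3) by blast
  qed
  thus "\<omega> \<in> orbit_closure (restrict liouville {1..})"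
    using \<omega> by (auto simp: orbit_closure_def in_closure_of full_shift_def)
qed


section \<open>Concentration of block sums of random signs\<close>

abbreviation (input) fair_sign :: "int measure" where
  "fair_sign \<equiv> uniform_count_measure {-1, 1}"

lemma prob_space_fair_sign: "prob_space fair_sign"
  by (rule prob_space_uniform_count_measure) auto

lemma space_bernoulli: "space bernoulli_measure = {1..} \<rightarrow>\<^sub>E {-1, 1}"
  by (simp add: bernoulli_measure_def space_PiM space_uniform_count_measure)

interpretation bernoulli: prob_space bernoulli_measure
  unfolding bernoulli_measure_def by (intro prob_space_PiM prob_space_fair_sign)

lemma measurable_fair_sign [measurable]: "(f :: int \<Rightarrow> real) \<in> borel_measurable fair_sign"
  by (auto simp: measurable_def sets_uniform_count_measure space_uniform_count_measure)

lemma measurable_coordinate [measurable]: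
  "i \<ge> 1 \<Longrightarrow> (\<lambda>\<omega>. \<omega> i) \<in> measurable bernoulli_measure fair_sign"
  unfolding bernoulli_measure_def by (rule measurable_component_singleton) auto

lemma measurable_sign [measurable]:
  "i \<ge> 1 \<Longrightarrow> (\<lambda>\<omega>. real_of_int (\<omega> i)) \<in> borel_measurable bernoulli_measure"
  by (rule measurable_compose[OF measurable_coordinate measurable_fair_sign])

lemma distr_coordinate: "i \<ge> 1 \<Longrightarrow> distr bernoulli_measure fair_sign (\<lambda>\<omega>. \<omega> i) = fair_sign"
  unfolding bernoulli_measure_def by (rule distr_PiM_component) (auto intro: prob_space_fair_sign)

lemma expectation_sign:
  assumes "i \<ge> 1"
  shows "bernoulli.expectation (\<lambda>\<omega>. real_of_int (\<omega> i)) = 0"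
proof -
  have "bernoulli.expectation (\<lambda>\<omega>. real_of_int (\<omega> i))
      = integral\<^sup>L (distr bernoulli_measure fair_sign (\<lambda>\<omega>. \<omega> i)) real_of_int"
    using assms by (intro integral_distr[symmetric]) auto
  also have "\<dots> = 0"
    using assms by (simp add: distr_coordinate integral_uniform_count_measure)
  finally show ?thesis .
qed

lemma indep_signs:
  assumes "finite J" "J \<noteq> {}" "J \<subseteq> {1..}"
  shows "bernoulli.indep_vars (\<lambda>_. borel) (\<lambda>i \<omega>. real_of_int (\<omega> i)) J"
proof -
  interpret product_prob_space "\<lambda>_. fair_sign" "{1..} :: nat set"
    by (intro product_prob_spaceI prob_space_fair_sign)
  have "bernoulli.indep_vars (\<lambda>_. fair_sign) (\<lambda>i \<omega>. \<omega> i) J"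
  proof (subst bernoulli.indep_vars_iff_distr_eq_PiM'[OF assms(2)])
    have "distr bernoulli_measure (PiM J (\<lambda>_. fair_sign)) (\<lambda>\<omega>. \<lambda>i\<in>J. \<omega> i) = PiM J (\<lambda>_. fair_sign)"
      unfolding bernoulli_measure_def by (rule distr_PiM_restrict_finite[OF assms(1,3)])
    also have "\<dots> = PiM J (\<lambda>i. distr bernoulli_measure fair_sign (\<lambda>\<omega>. \<omega> i))"
      using assms(3) by (intro PiM_cong) (auto simp: distr_coordinate)
    finally show "distr bernoulli_measure (PiM J (\<lambda>_. fair_sign)) (\<lambda>\<omega>. \<lambda>i\<in>J. \<omega> i)
        = PiM J (\<lambda>i. distr bernoulli_measure fair_sign (\<lambda>\<omega>. \<omega> i))" .
  qed (use assms(3) in \<open>auto intro: measurable_coordinate\<close>)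
  thus ?thesis
    by (rule bernoulli.indep_vars_compose2) simp
qed

lemma block_sum_tail:
  assumes "m \<ge> 1" "\<epsilon> \<ge> 0"
  shows "bernoulli.prob {\<omega> \<in> space bernoulli_measure.
      \<epsilon> * real m \<le> \<bar>\<Sum>n\<in>{a<..a+m}. real_of_int (\<omega> n)\<bar>} \<le> 2 * exp (- (\<epsilon>\<^sup>2 / 2) * real m)"
proof -
  interpret Hoeffding_ineq bernoulli_measure "{a<..a+m}" "\<lambda>i \<omega>. real_of_int (\<omega> i)" "\<lambda>_. -1" "\<lambda>_. 1"
      "\<Sum>i\<in>{a<..a+m}. bernoulli.expectation (\<lambda>\<omega>. real_of_int (\<omega> i))"
  proof unfold_locales
    show "bernoulli.indep_vars (\<lambda>_. borel) (\<lambda>i \<omega>. real_of_int (\<omega> i)) {a<..a+m}"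
      using assms by (intro indep_signs) auto
  next
    fix i assume "i \<in> {a<..a+m}"
    hence "\<omega> i \<in> {-1, 1}" if "\<omega> \<in> space bernoulli_measure" for \<omega>
      using that unfolding space_bernoulli by (intro PiE_mem[of \<omega> "{1..}"]) auto
    hence "real_of_int (\<omega> i) \<in> {-1..1}" if "\<omega> \<in> space bernoulli_measure" for \<omega>
      using that by fastforce
    thus "AE \<omega> in bernoulli_measure. real_of_int (\<omega> i) \<in> {-1..1}"
      by (rule AE_I2)
  qed auto
  have mean: "(\<Sum>i\<in>{a<..a+m}. bernoulli.expectation (\<lambda>\<omega>. real_of_int (\<omega> i))) = 0"
    by (intro sum.neutral ballI expectation_sign) auto
  have exponent: "- 2 * (\<epsilon> * real m)\<^sup>2 / (\<Sum>i\<in>{a<..a+m}. (1 - (-1::real))\<^sup>2) = - (\<epsilon>\<^sup>2 / 2) * real m"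
    using assms by (simp add: field_simps power2_eq_square)
  have "(\<Sum>i\<in>{a<..a+m}. (1 - (-1::real))\<^sup>2) > 0"
    using assms by simp
  from Hoeffding_ineq_abs_ge[OF _ this, of "\<epsilon> * real m"] show ?thesis
    using assms unfolding mean exponent by simp
qed

text \<open>At most quadratically many starting points compete with an exponentially small probability,
  so the union bound is summable over the block lengths \<open>m\<close> and the first Borel--Cantelli lemma
  applies. The range \<open>a \<le> (m + 1)\<^sup>2\<close> is where blocks with \<open>m\<close> of order at least \<open>sqrt a\<close> start.\<close>

lemma AE_block_sums_small:
  assumes "\<epsilon> > 0"
  shows "AE \<omega> in bernoulli_measure. \<forall>\<^sub>F m in sequentially. \<forall>a\<le>(m + 1)\<^sup>2.
    \<bar>\<Sum>n\<in>{a<..a+m}. real_of_int (\<omega> n)\<bar> < \<epsilon> * real m"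
proof -
  define E where "E m a = {\<omega> \<in> space bernoulli_measure.
      \<epsilon> * real m \<le> \<bar>\<Sum>n\<in>{a<..a+m}. real_of_int (\<omega> n)\<bar>}" for m a
  define B where "B m = (\<Union>a\<in>{..(m + 1)\<^sup>2}. E m a)" for m
  have E [measurable]: "E m a \<in> sets bernoulli_measure" for m a
  proof -
    have [measurable]: "(\<lambda>\<omega>. \<Sum>n\<in>{a<..a+m}. real_of_int (\<omega> n)) \<in> borel_measurable bernoulli_measure"
      by (intro borel_measurable_sum measurable_sign) auto
    show ?thesis unfolding E_def by measurable
  qed
  have B [measurable]: "B m \<in> sets bernoulli_measure" for m
    unfolding B_def by measurable
  have bound: "bernoulli.prob (B m) \<le> ((real m + 1)\<^sup>2 + 1) * (2 * exp (- (\<epsilon>\<^sup>2 / 2) * real m))"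
    if "m \<ge> 1" for m
  proof -
    have "bernoulli.prob (B m) \<le> (\<Sum>a\<in>{..(m + 1)\<^sup>2}. bernoulli.prob (E m a))"
      unfolding B_def by (rule measure_UNION_le) auto
    also have "\<dots> \<le> (\<Sum>a\<in>{..(m + 1)\<^sup>2}. 2 * exp (- (\<epsilon>\<^sup>2 / 2) * real m))"
      unfolding E_def using that assms by (intro sum_mono block_sum_tail) auto
    also have "\<dots> = ((real m + 1)\<^sup>2 + 1) * (2 * exp (- (\<epsilon>\<^sup>2 / 2) * real m))"
      by (simp add: algebra_simps)
    finally show ?thesis .
  qed
  define \<delta> where "\<delta> = \<epsilon>\<^sup>2 / 2"
  have "\<delta> > 0" using assms by (simp add: \<delta>_def)
  hence "(\<lambda>m. ((real m + 1)\<^sup>2 + 1) * (2 * exp (- \<delta> * real m))) \<in> O(\<lambda>m. 1 / real m ^ 2)"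
    by real_asymp
  hence "summable (\<lambda>m. ((real m + 1)\<^sup>2 + 1) * (2 * exp (- \<delta> * real m)))"
    by (rule summable_comparison_test_bigo[rotated])
       (use inverse_power_summable[of 2, where 'a = real] in \<open>simp add: inverse_eq_divide\<close>)
  hence "summable (\<lambda>m. bernoulli.prob (B m))"
    by (rule summable_comparison_test_ev[rotated])
       (use bound in \<open>auto simp: \<delta>_def intro!: eventually_mono[OF eventually_ge_at_top[of 1]]\<close>)
  hence "AE \<omega> in bernoulli_measure. \<forall>\<^sub>F m in sequentially. \<omega> \<in> space bernoulli_measure - B m"
    by (intro borel_cantelli_AE1 B) (auto simp: bernoulli.emeasure_eq_measure)
  thus ?thesis
  proof eventually_elim
    case (elim \<omega>)
    thus ?case
      by eventually_elim (auto simp: B_def E_def not_le)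
  qed
qed


section \<open>From blocks of integers to real short intervals\<close>

lemma random_mertens_diff:
  assumes "0 \<le> x" "0 \<le> h"
  shows "random_mertens \<omega> (x + h) - random_mertens \<omega> x = (\<Sum>n\<in>{nat \<lfloor>x\<rfloor><..nat \<lfloor>x + h\<rfloor>}. \<omega> n)"
proof -
  have M: "random_mertens \<omega> y = (\<Sum>n\<in>{1..nat \<lfloor>y\<rfloor>}. \<omega> n)" if "0 \<le> y" for y
    unfolding random_mertens_def by (rule sum.cong) (use that in \<open>auto simp: le_nat_iff le_floor_iff\<close>)
  have le: "nat \<lfloor>x\<rfloor> \<le> nat \<lfloor>x + h\<rfloor>"
    using assms by (intro nat_mono floor_mono) auto
  have "{1..nat \<lfloor>x + h\<rfloor>} = {1..nat \<lfloor>x\<rfloor>} \<union> {nat \<lfloor>x\<rfloor><..nat \<lfloor>x + h\<rfloor>}"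
    using le by auto
  moreover have "{1..nat \<lfloor>x\<rfloor>} \<inter> {nat \<lfloor>x\<rfloor><..nat \<lfloor>x + h\<rfloor>} = {}"
    by auto
  ultimately show ?thesis
    using assms by (simp only: M add_nonneg_nonneg sum.union_disjoint finite_atLeastAtMost
        finite_greaterThanAtMost)
qed

text \<open>For \<open>h \<ge> x powr \<tau> \<ge> sqrt x\<close> the integers in \<open>(x, x + h]\<close> form a block that starts at
  \<open>a = \<lfloor>x\<rfloor>\<close> and whose length \<open>m\<close> differs from \<open>h\<close> by less than \<open>1\<close>. So \<open>a \<le> (m + 1)\<^sup>2\<close>,
  uniformly in \<open>h\<close>, and the block lengths tend to infinity with \<open>x\<close>.\<close>

lemma short_interval_sup_tendsto_zero:
  assumes small: "\<And>\<epsilon>. \<epsilon> > 0 \<Longrightarrow> \<forall>\<^sub>F m in sequentially. \<forall>a\<le>(m + 1)\<^sup>2.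
      \<bar>\<Sum>n\<in>{a<..a+m}. real_of_int (\<omega> n)\<bar> < \<epsilon> * real m"
    and \<tau>: "\<tau> > 1/2"
  shows "(short_interval_sup \<omega> \<tau> \<longlongrightarrow> 0) at_top"
proof (rule tendsto_zero_ennreal)
  fix r :: real assume r: "r > 0"
  have "r / 4 > 0" using r by simp
  from small[OF this] obtain k where k: "\<forall>m\<ge>k. \<forall>a\<le>(m + 1)\<^sup>2.
      \<bar>\<Sum>n\<in>{a<..a+m}. real_of_int (\<omega> n)\<bar> < r / 4 * real m"
    unfolding eventually_sequentially by blast
  have "short_interval_sup \<omega> \<tau> x < ennreal r" if x: "x \<ge> (real k + 1)\<^sup>2" for x
  proof -
    have "(1::real) \<le> (real k + 1)\<^sup>2" by (rule one_le_power) simp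
    hence x1: "x \<ge> 1" using x by linarith
    have "\<bar>1 / h * (real_of_int (random_mertens \<omega> (x + h)) - real_of_int (random_mertens \<omega> x))\<bar> \<le> r / 2"
      if h: "h \<in> {x powr \<tau>..x}" for h
    proof -
      have "x powr (1/2) \<le> x powr \<tau>"
        using x1 \<tau> by (intro powr_mono) auto
      hence hx: "sqrt x \<le> h" using h x1 by (simp add: powr_half_sqrt)
      have "real k + 1 \<le> sqrt x" using x by (rule real_le_rsqrt)
      hence hk: "real k + 1 \<le> h" using hx by linarith
      define a where "a = nat \<lfloor>x\<rfloor>"
      define m where "m = nat \<lfloor>x + h\<rfloor> - a"
      have am: "nat \<lfloor>x + h\<rfloor> = a + m"
        unfolding m_def a_def using hk by (simp add: nat_mono floor_mono)
      have ra: "real a \<le> x" "x < real a + 1"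
        using x1 unfolding a_def by linarith+
      have "real (a + m) \<le> x + h" "x + h < real (a + m) + 1"
        using x1 hk unfolding am[symmetric] by linarith+
      hence m: "h - 1 < real m" "real m < h + 1"
        using ra by auto
      have "x \<le> h\<^sup>2"
        using hx by (simp add: sqrt_le_D)
      also have "\<dots> \<le> (real m + 1)\<^sup>2"
        using m hk by (intro power_mono) auto
      finally have "real a \<le> real ((m + 1)\<^sup>2)"
        using ra by (simp add: add.commute)
      hence "a \<le> (m + 1)\<^sup>2" by (simp only: of_nat_le_iff)
      moreover have "m \<ge> k" using m hk by linarith
      ultimately have "\<bar>\<Sum>n\<in>{a<..a+m}. real_of_int (\<omega> n)\<bar> < r / 4 * real m"
        using k by blast
      also have "\<dots> \<le> r / 4 * (2 * h)"
        using m hk r by (intro mult_left_mono) auto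
      finally have S: "\<bar>\<Sum>n\<in>{a<..a+m}. real_of_int (\<omega> n)\<bar> \<le> r / 2 * h"
        by (simp add: mult_ac)
      have "real_of_int (random_mertens \<omega> (x + h)) - real_of_int (random_mertens \<omega> x)
          = (\<Sum>n\<in>{a<..a+m}. real_of_int (\<omega> n))"
        using random_mertens_diff[of x h \<omega>] x1 hk unfolding am a_def[symmetric]
        by (simp flip: of_int_diff)
      thus ?thesis
        using S hk by (simp add: abs_mult divide_simps mult_ac)
    qed
    hence "short_interval_sup \<omega> \<tau> x \<le> ennreal (r / 2)"
      unfolding short_interval_sup_def by (intro SUP_least ennreal_leI)
    also have "\<dots> < ennreal r" using r by (intro ennreal_lessI) auto
    finally show ?thesis .
  qed
  thus "\<forall>\<^sub>F x in at_top. short_interval_sup \<omega> \<tau> x < ennreal r"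
    by (auto simp: eventually_at_top_linorder)
qed

theorem theorem6p10:
  assumes "chowla_conjecture"
  shows "AE \<omega> in bernoulli_measure.
    \<omega> \<in> orbit_closure (restrict liouville {1..}) \<and>
    (\<forall>\<tau>>1/2. (short_interval_sup \<omega> \<tau> \<longlongrightarrow> 0) at_top)"
proof -
  have "AE \<omega> in bernoulli_measure. \<forall>j::nat. \<forall>\<^sub>F m in sequentially. \<forall>a\<le>(m + 1)\<^sup>2.
      \<bar>\<Sum>n\<in>{a<..a+m}. real_of_int (\<omega> n)\<bar> < inverse (real (Suc j)) * real m"
    unfolding AE_all_countable by (intro allI AE_block_sums_small) simp
  moreover have "AE \<omega> in bernoulli_measure. \<omega> \<in> {1..} \<rightarrow>\<^sub>E {-1, 1}"
    by (rule AE_I2) (simp add: space_bernoulli)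
  ultimately show ?thesis
  proof eventually_elim
    case (elim \<omega>)
    have "(short_interval_sup \<omega> \<tau> \<longlongrightarrow> 0) at_top" if "\<tau> > 1/2" for \<tau>
    proof (rule short_interval_sup_tendsto_zero[OF _ that])
      fix \<epsilon> :: real assume "\<epsilon> > 0"
      then obtain j where j: "inverse (real (Suc j)) < \<epsilon>"
        using reals_Archimedean by blast
      have "inverse (real (Suc j)) * real m \<le> \<epsilon> * real m" for m
        using j by (intro mult_right_mono) auto
      note larger = order_less_le_trans[OF _ this]
      show "\<forall>\<^sub>F m in sequentially. \<forall>a\<le>(m + 1)\<^sup>2. \<bar>\<Sum>n\<in>{a<..a+m}. real_of_int (\<omega> n)\<bar> < \<epsilon> * real m"
        using elim(1)[THEN spec, of j] by eventually_elim (blast intro: larger)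
    qed
    thus ?case
      using elim(2) chowla_imp_orbit_closure_full[OF assms] by simp
  qed
qed

end
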